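(* Let $\Bbbk$ be a field, $H$ a weak Hopf algebra over $\Bbbk$, $A$ an associative unital $\Bbbk$-algebra, $e,f\in \mathrm{Hom}(H,A)$ nonzero idempotents of the convolution algebra $\mathrm{Hom}(H,A)$, and $u\in\mathrm{Hom}(H,A)$ an $(e,f)$-invertible element with $(e,f)$-inverse $u^{-1}$. For $h\in H$, $a\in A$ put $$h\cdot a := u(h_1)\,a\,u^{-1}(h_2).$$ (This is only a linear map $H\otimes A\to A$; no module property is assumed.) Then the following statements hold. (i) One has $h\cdot(ab)=(h_1\cdot a)(h_2\cdot b)$ for all $h\in H$, $a,b\in A$ if and only if $\varphi_{f,h}(ab)=\varphi_{f,h_1}(a)\,\varphi_{f,h_2}(b)$ for all $h\in H$, $a,b\in A$, where $\varphi_{f,h}(a):=f(h_1)\,a\,f(h_2)$. (ii) The following are equivalent: $h\cdot 1=\varepsilon_t(h)\cdot 1$ for all $h\in H$; $e\circ\varepsilon_t=e$; $\ker(\varepsilon_t)\subseteq\ker(e)$. (iii) Suppose $f(H)\subseteq C(A)$. Then $g\cdot(h\cdot a)=(gh)\cdot a$ for all $g,h\in H$, $a\in A$ if and only if $g\cdot e(h)=e(gh)$ for all $g,h\in H$ and $t(H\times H)\subseteq C(A)$, where $t:H\times H\to A$ is the bilinear map $t(x,y)=u^{-1}(y_1)\,u^{-1}(x_1)\,u(x_2y_2)$. (iv) If $u(H_s)\subseteq C(A)$ and $e(1)=1$, then $1\cdot a=a$ for all $a\in A$. (v) If $\lambda(1):=u(1_1)\otimes u^{-1}(1_2)\in A\otimes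 A$ belongs to $C_{A\otimes A}(u(H_s))$ and $1\cdot a=a$ for all $a\in A$, then $e(1)=1$ and $u(H_s)\subseteq C(A)$.
   Context: Algebras are associative and unital over the field $\Bbbk$; $C(A)$ is the center of $A$. Sweedler notation $\Delta(c)=c_1\otimes c_2$ (summation understood) is used; $\Delta(1)=1_1\otimes 1_2$. A weak Hopf algebra over $\Bbbk$ is a finite dimensional vector space $H$ with an algebra structure, a coalgebra structure $(\Delta,\varepsilon)$ and a linear map $S:H\to H$ (antipode) such that for all $g,h,l\in H$: $\Delta(hg)=\Delta(h)\Delta(g)$; $\Delta^2(1)=(\Delta(1)\otimes 1)(1\otimes\Delta(1))=(1\otimes\Delta(1))(\Delta(1)\otimes 1)$; $\varepsilon(hgl)=\varepsilon(hg_1)\varepsilon(g_2l)=\varepsilon(hg_2)\varepsilon(g_1l)$; $h_1S(h_2)=\varepsilon(1_1h)1_2$; $S(h_1)h_2=1_1\varepsilon(h1_2)$; $S(h_1)h_2S(h_3)=S(h)$. Put $\varepsilon_t(h)=h_1S(h_2)=\varepsilon(1_1h)1_2$, $\varepsilon_s(h)=S(h_1)h_2=1_1\varepsilon(h1_2)$, $H_t=\{h:\varepsilon_t(h)=h\}$, $H_s=\{h:\varepsilon_s(h)=h\}$. $\mathrm{Hom}(H,A)$ (linear maps) is an algebra under convolution $(\varphi*\psi)(h)=\varphi(h_1)\psi(h_2)$. For a ring $R$ and nonzero idempotents $e,f\in R$, an element $u\in R$ is $(e,f)$-invertible if there is $v\in R$ with $uv=e$, $vu=f$, $u=uf$ and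 $fv=v$. Such a $v$ is unique, is called the $(e,f)$-inverse of $u$, and is denoted $u^{-1}$. Here this is applied to $R=\mathrm{Hom}(H,A)$ with the convolution product. For a subset $S\subseteq A$, $C_{A\otimes A}(S)=\{y\in A\otimes A:(s\otimes 1)y=y(1\otimes s)\text{ for all }s\in S\}$. *)

theory Defs
  imports Complex_Main
begin

section \<open>Tensor squares and cubes of a vector space\<close>

text \<open>
  The tensor product is formed as finite formal sums of pure tensors modulo multilinearity.
  A list \<open>[(v\<^sub>1, w\<^sub>1), \<dots>, (v\<^sub>n, w\<^sub>n)]\<close> stands for
  the sum of the \<open>v\<^sub>i \<otimes> w\<^sub>i\<close>, and an element of \<open>V \<otimes> V\<close> is a
  congruence class of such lists. Scalars act through one factor and
  \<open>(- v) \<otimes> w\<close> is the negative of \<open>v \<otimes> w\<close>, so neither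
  coefficients nor formal differences are needed. The relation \<open>0 \<otimes> w = 0\<close> has to be
  imposed, since on formal sums without differences additivity alone does not identify
  \<open>0 \<otimes> w\<close> with the empty sum.
\<close>

inductive formal_cong :: "('x list \<Rightarrow> 'x list \<Rightarrow> bool) \<Rightarrow> 'x list \<Rightarrow> 'x list \<Rightarrow> bool"
  for R where
  base: "R xs ys \<Longrightarrow> formal_cong R xs ys"
| refl: "formal_cong R xs xs"
| sym: "formal_cong R xs ys \<Longrightarrow> formal_cong R ys xs"
| trans: "formal_cong R xs ys \<Longrightarrow> formal_cong R ys zs \<Longrightarrow> formal_cong R xs zs"
| comm: "formal_cong R (xs @ ys) (ys @ xs)"
| append: "formal_cong R xs ys \<Longrightarrow> formal_cong R xs' ys' \<Longrightarrow> formal_cong R (xs @ xs') (ys @ ys')"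

inductive bilin_rel :: "('k::field \<Rightarrow> 'v::ab_group_add \<Rightarrow> 'v) \<Rightarrow>
    ('v \<times> 'v) list \<Rightarrow> ('v \<times> 'v) list \<Rightarrow> bool"
  for scale where
  "bilin_rel scale [(v + v', w)] [(v, w), (v', w)]"
| "bilin_rel scale [(v, w + w')] [(v, w), (v, w')]"
| "bilin_rel scale [(scale c v, w)] [(v, scale c w)]"
| "bilin_rel scale [(0, w)] []"

inductive trilin_rel :: "('k::field \<Rightarrow> 'v::ab_group_add \<Rightarrow> 'v) \<Rightarrow>
    ('v \<times> 'v \<times> 'v) list \<Rightarrow> ('v \<times> 'v \<times> 'v) list \<Rightarrow> bool"
  for scale where
  "trilin_rel scale [(v + v', w, z)] [(v, w, z), (v', w, z)]"
| "trilin_rel scale [(v, w + w', z)] [(v, w, z), (v, w', z)]"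
| "trilin_rel scale [(v, w, z + z')] [(v, w, z), (v, w, z')]"
| "trilin_rel scale [(scale c v, w, z)] [(v, scale c w, z)]"
| "trilin_rel scale [(v, scale c w, z)] [(v, w, scale c z)]"
| "trilin_rel scale [(0, w, z)] []"

definition tensor2 :: "('k::field \<Rightarrow> 'v::ab_group_add \<Rightarrow> 'v) \<Rightarrow>
    ('v \<times> 'v) list \<Rightarrow> ('v \<times> 'v) list set" where
  "tensor2 scale xs = {ys. formal_cong (bilin_rel scale) xs ys}"

definition tensor3 :: "('k::field \<Rightarrow> 'v::ab_group_add \<Rightarrow> 'v) \<Rightarrow>
    ('v \<times> 'v \<times> 'v) list \<Rightarrow> ('v \<times> 'v \<times> 'v) list set" where
  "tensor3 scale xs = {ys. formal_cong (trilin_rel scale) xs ys}"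

definition tensor_square :: "('k::field \<Rightarrow> 'v::ab_group_add \<Rightarrow> 'v) \<Rightarrow> ('v \<times> 'v) list set set" where
  "tensor_square scale = range (tensor2 scale)"

definition rep :: "'x list set \<Rightarrow> 'x list" where
  "rep t = (SOME xs. xs \<in> t)"

definition tadd :: "('k::field \<Rightarrow> 'v::ab_group_add \<Rightarrow> 'v) \<Rightarrow>
    ('v \<times> 'v) list set \<Rightarrow> ('v \<times> 'v) list set \<Rightarrow> ('v \<times> 'v) list set" where
  "tadd scale t t' = tensor2 scale (rep t @ rep t')"

definition tscale :: "('k::field \<Rightarrow> 'v::ab_group_add \<Rightarrow> 'v) \<Rightarrow>
    'k \<Rightarrow> ('v \<times> 'v) list set \<Rightarrow> ('v \<times> 'v) list set" where
  "tscale scale c t = tensor2 scale [(scale c x, y). (x, y) \<leftarrow> rep t]"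

definition tmult :: "('k::field \<Rightarrow> 'v::ring \<Rightarrow> 'v) \<Rightarrow>
    ('v \<times> 'v) list set \<Rightarrow> ('v \<times> 'v) list set \<Rightarrow> ('v \<times> 'v) list set" where
  "tmult scale t t' = tensor2 scale [(x * x', y * y'). (x, y) \<leftarrow> rep t, (x', y') \<leftarrow> rep t']"

definition tmult3 :: "('k::field \<Rightarrow> 'v::ring \<Rightarrow> 'v) \<Rightarrow>
    ('v \<times> 'v \<times> 'v) list set \<Rightarrow> ('v \<times> 'v \<times> 'v) list set \<Rightarrow> ('v \<times> 'v \<times> 'v) list set" where
  "tmult3 scale t t' =
    tensor3 scale [(x * x', y * y', z * z'). (x, y, z) \<leftarrow> rep t, (x', y', z') \<leftarrow> rep t']"

text \<open>
  Sweedler sums: \<open>tsum (\<Delta> h) (\<lambda>h\<^sub>1 h\<^sub>2. B h\<^sub>1 h\<^sub>2)\<close> is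
  \<open>B(h\<^sub>1, h\<^sub>2)\<close> with summation understood. For bilinear \<open>B\<close> it does not depend
  on the representative, see \<open>tsum_tensor2\<close> below; likewise \<open>tsum3\<close> for trilinear maps.
\<close>

definition tsum :: "('v \<times> 'w) list set \<Rightarrow> ('v \<Rightarrow> 'w \<Rightarrow> 'x::comm_monoid_add) \<Rightarrow> 'x" where
  "tsum t B = (\<Sum>(x, y)\<leftarrow>rep t. B x y)"

definition tsum3 :: "('v \<times> 'w \<times> 'z) list set \<Rightarrow> ('v \<Rightarrow> 'w \<Rightarrow> 'z \<Rightarrow> 'x::comm_monoid_add) \<Rightarrow> 'x" where
  "tsum3 t B = (\<Sum>(x, y, z)\<leftarrow>rep t. B x y z)"

lemma rep_tensor2: "formal_cong (bilin_rel scale) xs (rep (tensor2 scale xs))"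
  unfolding rep_def tensor2_def mem_Collect_eq
  by (rule someI) (rule formal_cong.refl)

lemma rep_tensor3: "formal_cong (trilin_rel scale) xs (rep (tensor3 scale xs))"
  unfolding rep_def tensor3_def mem_Collect_eq
  by (rule someI) (rule formal_cong.refl)

lemma formal_cong_sum_list:
  fixes F :: "'x \<Rightarrow> 'y::comm_monoid_add"
  assumes "formal_cong R xs ys"
    and "\<And>us vs. R us vs \<Longrightarrow> sum_list (map F us) = sum_list (map F vs)"
  shows "sum_list (map F xs) = sum_list (map F ys)"
  using assms(1) by induction (auto simp: assms(2) add.commute)

lemma tsum_tensor2:
  fixes B :: "'v::ab_group_add \<Rightarrow> 'v \<Rightarrow> 'x::ab_group_add"
  assumes "\<And>v v' w. B (v + v') w = B v w + B v' w"
    and "\<And>v w w'. B v (w + w') = B v w + B v w'"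
    and "\<And>c v w. B (scale c v) w = B v (scale c w)"
  shows "tsum (tensor2 scale xs) B = (\<Sum>(x, y)\<leftarrow>xs. B x y)"
proof -
  have B0: "B 0 w = 0" for w
    using assms(1)[of 0 0 w] by simp
  show ?thesis
    unfolding tsum_def
    by (rule formal_cong_sum_list[OF formal_cong.sym[OF rep_tensor2]])
       (auto elim!: bilin_rel.cases simp: assms B0)
qed

lemma tsum3_tensor3:
  fixes B :: "'v::ab_group_add \<Rightarrow> 'v \<Rightarrow> 'v \<Rightarrow> 'x::ab_group_add"
  assumes "\<And>v v' w z. B (v + v') w z = B v w z + B v' w z"
    and "\<And>v w w' z. B v (w + w') z = B v w z + B v w' z"
    and "\<And>v w z z'. B v w (z + z') = B v w z + B v w z'"
    and "\<And>c v w z. B (scale c v) w z = B v (scale c w) z"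
    and "\<And>c v w z. B v (scale c w) z = B v w (scale c z)"
  shows "tsum3 (tensor3 scale xs) B = (\<Sum>(x, y, z)\<leftarrow>xs. B x y z)"
proof -
  have B0: "B 0 w z = 0" for w z
    using assms(1)[of 0 0 w z] by simp
  have gen: "sum_list (map (\<lambda>(x, y, z). B x y z) us) = sum_list (map (\<lambda>(x, y, z). B x y z) vs)"
    if "trilin_rel scale us vs" for us vs
    using that by cases (simp_all only: list.map sum_list.Cons sum_list.Nil prod.case add_0_right
        assms(1-3) assms(4) assms(5) B0)
  show ?thesis
    unfolding tsum3_def
    by (rule formal_cong_sum_list[OF formal_cong.sym[OF rep_tensor3]]) (rule gen)
qed


section \<open>Algebras and weak Hopf algebras\<close>

text \<open>The sort \<open>{ring, monoid_mult}\<close> is \<open>ring_1\<close> without \<open>0 \<noteq> 1\<close>.\<close>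

locale unital_algebra = vector_space scale
  for scale :: "'k::field \<Rightarrow> 'a::{ring,monoid_mult} \<Rightarrow> 'a" +
  assumes scale_mult_left: "scale c a * b = scale c (a * b)"
    and scale_mult_right: "a * scale c b = scale c (a * b)"

definition center :: "'a::ring set" where
  "center = {z. \<forall>a. z * a = a * z}"

locale coalgebra = vector_space scale
  for scale :: "'k::field \<Rightarrow> 'h::ab_group_add \<Rightarrow> 'h"
    and \<Delta> :: "'h \<Rightarrow> ('h \<times> 'h) list set"
    and \<epsilon> :: "'h \<Rightarrow> 'k" +
  assumes comult_in: "\<Delta> h \<in> tensor_square scale"
    and comult_add: "\<Delta> (g + h) = tadd scale (\<Delta> g) (\<Delta> h)"
    and comult_scale: "\<Delta> (scale c h) = tscale scale c (\<Delta> h)"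
    and counit_linear: "Vector_Spaces.linear scale (*) \<epsilon>"
    and coassoc: "tensor3 scale [(x, y, h2). (h1, h2) \<leftarrow> rep (\<Delta> h), (x, y) \<leftarrow> rep (\<Delta> h1)]
                = tensor3 scale [(h1, x, y). (h1, h2) \<leftarrow> rep (\<Delta> h), (x, y) \<leftarrow> rep (\<Delta> h2)]"
    and counit_left: "tsum (\<Delta> h) (\<lambda>h1 h2. scale (\<epsilon> h1) h2) = h"
    and counit_right: "tsum (\<Delta> h) (\<lambda>h1 h2. scale (\<epsilon> h2) h1) = h"

definition comult2 :: "('k::field \<Rightarrow> 'h::ab_group_add \<Rightarrow> 'h) \<Rightarrow>
    ('h \<Rightarrow> ('h \<times> 'h) list set) \<Rightarrow> 'h \<Rightarrow> ('h \<times> 'h \<times> 'h) list set" where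
  "comult2 scale \<Delta> h =
    tensor3 scale [(x, y, h2). (h1, h2) \<leftarrow> rep (\<Delta> h), (x, y) \<leftarrow> rep (\<Delta> h1)]"

locale weak_hopf_algebra = unital_algebra scale + coalgebra scale \<Delta> \<epsilon>
  for scale :: "'k::field \<Rightarrow> 'h::{ring,monoid_mult} \<Rightarrow> 'h"
    and \<Delta> :: "'h \<Rightarrow> ('h \<times> 'h) list set"
    and \<epsilon> :: "'h \<Rightarrow> 'k"
    and S :: "'h \<Rightarrow> 'h" +
  assumes finite_dim: "\<exists>Basis. finite_dimensional_vector_space scale Basis"
    and antipode_linear: "Vector_Spaces.linear scale scale S"
    and comult_mult: "\<Delta> (h * g) = tmult scale (\<Delta> h) (\<Delta> g)"
    and comult2_one:
      "comult2 scale \<Delta> 1 = tmult3 scale (tensor3 scale [(x, y, 1). (x, y) \<leftarrow> rep (\<Delta> 1)])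
                                     (tensor3 scale [(1, x, y). (x, y) \<leftarrow> rep (\<Delta> 1)])"
      "comult2 scale \<Delta> 1 = tmult3 scale (tensor3 scale [(1, x, y). (x, y) \<leftarrow> rep (\<Delta> 1)])
                                     (tensor3 scale [(x, y, 1). (x, y) \<leftarrow> rep (\<Delta> 1)])"
    and counit_mult:
      "\<epsilon> (h * g * l) = tsum (\<Delta> g) (\<lambda>g1 g2. \<epsilon> (h * g1) * \<epsilon> (g2 * l))"
      "\<epsilon> (h * g * l) = tsum (\<Delta> g) (\<lambda>g1 g2. \<epsilon> (h * g2) * \<epsilon> (g1 * l))"
    and antipode_target:
      "tsum (\<Delta> h) (\<lambda>h1 h2. h1 * S h2) = tsum (\<Delta> 1) (\<lambda>x y. scale (\<epsilon> (x * h)) y)"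
    and antipode_source:
      "tsum (\<Delta> h) (\<lambda>h1 h2. S h1 * h2) = tsum (\<Delta> 1) (\<lambda>x y. scale (\<epsilon> (h * y)) x)"
    and antipode: "tsum3 (comult2 scale \<Delta> h) (\<lambda>h1 h2 h3. S h1 * h2 * S h3) = S h"

definition eps_t :: "('h \<Rightarrow> ('h \<times> 'h) list set) \<Rightarrow> ('h \<Rightarrow> 'h) \<Rightarrow> 'h::ring \<Rightarrow> 'h" where
  "eps_t \<Delta> S h = tsum (\<Delta> h) (\<lambda>h1 h2. h1 * S h2)"

definition eps_s :: "('h \<Rightarrow> ('h \<times> 'h) list set) \<Rightarrow> ('h \<Rightarrow> 'h) \<Rightarrow> 'h::ring \<Rightarrow> 'h" where
  "eps_s \<Delta> S h = tsum (\<Delta> h) (\<lambda>h1 h2. S h1 * h2)"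

definition H_s :: "('h \<Rightarrow> ('h \<times> 'h) list set) \<Rightarrow> ('h \<Rightarrow> 'h) \<Rightarrow> 'h::ring set" where
  "H_s \<Delta> S = {h. eps_s \<Delta> S h = h}"


section \<open>Convolution, \<open>(e,f)\<close>-invertibility and the induced map \<open>H \<otimes> A \<rightarrow> A\<close>\<close>

definition Hom :: "('k::field \<Rightarrow> 'h::ab_group_add \<Rightarrow> 'h) \<Rightarrow>
    ('k \<Rightarrow> 'a::ab_group_add \<Rightarrow> 'a) \<Rightarrow> ('h \<Rightarrow> 'a) set" where
  "Hom sH sA = {\<phi>. Vector_Spaces.linear sH sA \<phi>}"

definition conv :: "('h \<Rightarrow> ('h \<times> 'h) list set) \<Rightarrow> ('h \<Rightarrow> 'a::ring) \<Rightarrow> ('h \<Rightarrow> 'a) \<Rightarrow> 'h \<Rightarrow> 'a" where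
  "conv \<Delta> \<phi> \<psi> h = tsum (\<Delta> h) (\<lambda>h1 h2. \<phi> h1 * \<psi> h2)"

definition idempotent_in :: "'r set \<Rightarrow> ('r \<Rightarrow> 'r \<Rightarrow> 'r) \<Rightarrow> 'r \<Rightarrow> bool" where
  "idempotent_in R mul e \<longleftrightarrow> e \<in> R \<and> mul e e = e"

text \<open>\<open>u\<close> is \<open>(e,f)\<close>-invertible with \<open>(e,f)\<close>-inverse \<open>v\<close>
  in the ring with carrier \<open>R\<close> and product \<open>mul\<close>.\<close>

definition ef_inverse :: "'r set \<Rightarrow> ('r \<Rightarrow> 'r \<Rightarrow> 'r) \<Rightarrow> 'r \<Rightarrow> 'r \<Rightarrow> 'r \<Rightarrow> 'r \<Rightarrow> bool" where
  "ef_inverse R mul e f u v \<longleftrightarrow>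
    u \<in> R \<and> v \<in> R \<and> mul u v = e \<and> mul v u = f \<and> u = mul u f \<and> mul f v = v"

definition act :: "('h \<Rightarrow> ('h \<times> 'h) list set) \<Rightarrow> ('h \<Rightarrow> 'a::ring) \<Rightarrow> ('h \<Rightarrow> 'a) \<Rightarrow> 'h \<Rightarrow> 'a \<Rightarrow> 'a" where
  "act \<Delta> u v h a = tsum (\<Delta> h) (\<lambda>h1 h2. u h1 * a * v h2)"

definition phi :: "('h \<Rightarrow> ('h \<times> 'h) list set) \<Rightarrow> ('h \<Rightarrow> 'a::ring) \<Rightarrow> 'h \<Rightarrow> 'a \<Rightarrow> 'a" where
  "phi \<Delta> f h a = tsum (\<Delta> h) (\<lambda>h1 h2. f h1 * a * f h2)"

definition tmap :: "('h::ring \<Rightarrow> ('h \<times> 'h) list set) \<Rightarrow> ('h \<Rightarrow> 'a::ring) \<Rightarrow> ('h \<Rightarrow> 'a) \<Rightarrow> 'h \<Rightarrow> 'h \<Rightarrow> 'a" where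
  "tmap \<Delta> u v x y = tsum (\<Delta> x) (\<lambda>x1 x2. tsum (\<Delta> y) (\<lambda>y1 y2. v y1 * v x1 * u (x2 * y2)))"

definition lambda1 :: "('k::field \<Rightarrow> 'a::ring \<Rightarrow> 'a) \<Rightarrow>
    ('h::{ring,monoid_mult} \<Rightarrow> ('h \<times> 'h) list set) \<Rightarrow>
    ('h \<Rightarrow> 'a) \<Rightarrow> ('h \<Rightarrow> 'a) \<Rightarrow> ('a \<times> 'a) list set" where
  "lambda1 sA \<Delta> u v = tensor2 sA [(u x, v y). (x, y) \<leftarrow> rep (\<Delta> 1)]"

definition C_tensor :: "('k::field \<Rightarrow> 'a::{ring,monoid_mult} \<Rightarrow> 'a) \<Rightarrow>
    'a set \<Rightarrow> ('a \<times> 'a) list set set" where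
  "C_tensor sA T = {y \<in> tensor_square sA.
     \<forall>s\<in>T. tmult sA (tensor2 sA [(s, 1)]) y = tmult sA y (tensor2 sA [(1, s)])}"

end

theory Submission
  imports Defs
begin

text \<open>
  Write \<open>v\<close> for \<open>u\<^sup>-\<^sup>1\<close>. Identifying \<open>a \<in> A\<close> with the map \<open>\<epsilon>(-)a\<close>, the map
  \<open>h \<mapsto> h \<cdot> a\<close> is the convolution product \<open>u a v\<close>. Hence (i) compares \<open>u X v = u Y v\<close>
  with \<open>f X f = f Y f\<close> for \<open>X = ab\<close> and \<open>Y = a f b\<close>, and either equation is obtained from the other
  by multiplying from both sides. For (iii) the same is done in the convolution algebra of
  \<open>H \<otimes> H\<close>: with \<open>U = u(x)u(y)\<close>, \<open>V = v(y)v(x)\<close>, \<open>M = u(xy)\<close>, \<open>N = v(xy)\<close> the associativity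
  of the action reads \<open>U a V = M a N\<close>, the condition on \<open>e\<close> reads \<open>U V = M N\<close>, and \<open>t = V M\<close>;
  centrality of \<open>f\<close> gives \<open>V U V = V\<close> and makes \<open>V U\<close> and \<open>N M\<close> commute with \<open>A\<close>.
  Part (ii) rests on \<open>h \<cdot> 1 = e(h)\<close> and the idempotence of \<open>\<epsilon>\<^sub>t\<close>, part (iv) on
  \<open>\<Delta>(1) \<in> H\<^sub>s \<otimes> H\<close>, and (v) is the hypothesis on \<open>\<lambda>(1)\<close> evaluated under
  \<open>x \<otimes> y \<mapsto> x a y\<close>.
\<close>

section \<open>Sweedler sums under additive maps and products\<close>

lemma sum_list_additive:
  assumes "\<And>x y. \<phi> (x + y) = \<phi> x + \<phi> y" and "\<phi> 0 = 0"
  shows "\<phi> (sum_list (map F xs)) = (\<Sum>x\<leftarrow>xs. \<phi> (F x))"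
  by (induction xs) (simp_all add: assms)

lemma tsum_additive:
  assumes "\<And>x y. \<phi> (x + y) = \<phi> x + \<phi> y" and "\<phi> 0 = 0"
  shows "\<phi> (tsum t B) = tsum t (\<lambda>x y. \<phi> (B x y))"
  unfolding tsum_def by (subst sum_list_additive[of \<phi>, OF assms]) (simp_all add: split_def)

lemma tsum_add: "tsum t (\<lambda>x y. B x y + C x y) = tsum t B + tsum t C"
  unfolding tsum_def split_def by (simp add: sum_list_addf)

lemma tsum_mult_left: "a * tsum t B = tsum t (\<lambda>x y. a * B x y)" for a :: "'a::ring"
  by (rule tsum_additive) (simp_all add: distrib_left)

lemma tsum_mult_right: "tsum t B * a = tsum t (\<lambda>x y. B x y * a)" for a :: "'a::ring"
  by (rule tsum_additive[of "\<lambda>x. x * a"]) (simp_all add: distrib_right)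

lemma tsum_swap:
  fixes B :: "'a \<Rightarrow> 'b \<Rightarrow> 'd \<Rightarrow> 'e \<Rightarrow> 'c::comm_monoid_add"
  shows "tsum s (\<lambda>x y. tsum t (B x y)) = tsum t (\<lambda>z w. tsum s (\<lambda>x y. B x y z w))"
proof -
  have "(\<Sum>p\<leftarrow>ps. \<Sum>q\<leftarrow>qs. F p q) = (\<Sum>q\<leftarrow>qs. \<Sum>p\<leftarrow>ps. F p q)"
    for ps :: "('a \<times> 'b) list" and qs :: "('d \<times> 'e) list" and F :: "_ \<Rightarrow> _ \<Rightarrow> 'c::comm_monoid_add"
    by (induction ps) (simp_all add: sum_list_addf)
  then show ?thesis
    unfolding tsum_def split_def .
qed

lemma sum_list_bind_pairs:
  "(\<Sum>p\<leftarrow>concat (map g xs). F p) = (\<Sum>x\<leftarrow>xs. \<Sum>p\<leftarrow>g x. F p)"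
  by (induction xs) simp_all

section \<open>Linear maps and their closure properties\<close>

lemma Hom_vector_space:
  assumes "\<phi> \<in> Hom s1 s2"
  shows "vector_space s1" and "vector_space s2"
  using assms unfolding Hom_def Vector_Spaces.linear_iff by simp_all

lemma Hom_iff:
  assumes "vector_space s1" and "vector_space s2"
  shows "\<phi> \<in> Hom s1 s2 \<longleftrightarrow>
    (\<forall>x y. \<phi> (x + y) = \<phi> x + \<phi> y) \<and> (\<forall>c x. \<phi> (s1 c x) = s2 c (\<phi> x))"
  using assms unfolding Hom_def Vector_Spaces.linear_iff by simp

lemma Hom_add: "\<phi> \<in> Hom s1 s2 \<Longrightarrow> \<phi> (x + y) = \<phi> x + \<phi> y"
  and Hom_scale: "\<phi> \<in> Hom s1 s2 \<Longrightarrow> \<phi> (s1 c x) = s2 c (\<phi> x)"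
  using Hom_iff[OF Hom_vector_space] by blast+

lemma Hom_0: "\<phi> \<in> Hom s1 s2 \<Longrightarrow> \<phi> 0 = 0"
  using Hom_add[of \<phi> s1 s2 0 0] by simp

lemma Hom_diff: "\<phi> \<in> Hom s1 s2 \<Longrightarrow> \<phi> (x - y) = \<phi> x - \<phi> y"
  using Hom_add[of \<phi> s1 s2 "x - y" y] by simp

lemma Hom_apply_tsum: "\<phi> \<in> Hom s1 s2 \<Longrightarrow> \<phi> (tsum t B) = tsum t (\<lambda>x y. \<phi> (B x y))"
  by (rule tsum_additive) (auto simp: Hom_add Hom_0)

lemma (in vector_space) scale_tsum: "scale c (tsum t B) = tsum t (\<lambda>x y. scale c (B x y))"
  by (rule tsum_additive) (simp_all add: scale_right_distrib)

lemma Hom_tsum: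
  assumes "\<And>y z. (\<lambda>x. F x y z) \<in> Hom s1 s2"
  shows "(\<lambda>x. tsum t (F x)) \<in> Hom s1 s2"
proof -
  \<comment> \<open>The arguments are dummies: linearity of any one map of the family certifies that
    both scalings are vector spaces.\<close>
  note vs = Hom_vector_space[OF assms[of undefined undefined]]
  interpret T: vector_space s2 by (rule vs)
  have "F (x + x') = (\<lambda>y z. F x y z + F x' y z)" and "F (s1 c x) = (\<lambda>y z. s2 c (F x y z))"
    for x x' c
    by (simp_all add: fun_eq_iff Hom_add[OF assms] Hom_scale[OF assms])
  then show ?thesis
    unfolding Hom_iff[OF vs] by (simp add: T.scale_tsum tsum_add)
qed

lemma Hom_comp:
  assumes "\<phi> \<in> Hom s2 s3" and "\<psi> \<in> Hom s1 s2"
  shows "(\<lambda>x. \<phi> (\<psi> x)) \<in> Hom s1 s3"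
  unfolding Hom_iff[OF Hom_vector_space(1)[OF assms(2)] Hom_vector_space(2)[OF assms(1)]]
  by (simp add: Hom_add[OF assms(1)] Hom_add[OF assms(2)] Hom_scale[OF assms(1)] Hom_scale[OF assms(2)])

lemma Hom_scale_left:
  assumes "vector_space s2" and "\<phi> \<in> Hom s1 (*)"
  shows "(\<lambda>x. s2 (\<phi> x) a) \<in> Hom s1 s2"
proof -
  interpret T: vector_space s2 by fact
  show ?thesis
    unfolding Hom_iff[OF Hom_vector_space(1)[OF assms(2)] assms(1)]
    by (simp add: Hom_add[OF assms(2)] Hom_scale[OF assms(2)] T.scale_left_distrib)
qed

lemma Hom_scale_right:
  assumes "\<phi> \<in> Hom s1 s2"
  shows "(\<lambda>x. s2 c (\<phi> x)) \<in> Hom s1 s2"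
proof -
  interpret T: vector_space s2 using Hom_vector_space[OF assms] by simp
  show ?thesis
    unfolding Hom_iff[OF Hom_vector_space[OF assms]]
    by (simp add: Hom_add[OF assms] Hom_scale[OF assms] T.scale_right_distrib T.scale_left_commute)
qed

lemma (in vector_space) Hom_id: "(\<lambda>x. x) \<in> Hom scale scale"
  by (simp add: Hom_iff[OF vector_space_axioms vector_space_axioms])

lemma (in unital_algebra) Hom_mult_left:
  "\<phi> \<in> Hom s1 scale \<Longrightarrow> (\<lambda>x. a * \<phi> x) \<in> Hom s1 scale"
  using Hom_vector_space[of \<phi> s1 scale]
  by (simp add: Hom_iff distrib_left scale_mult_right)

lemma (in unital_algebra) Hom_mult_right:
  "\<phi> \<in> Hom s1 scale \<Longrightarrow> (\<lambda>x. \<phi> x * a) \<in> Hom s1 scale"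
  using Hom_vector_space[of \<phi> s1 scale]
  by (simp add: Hom_iff distrib_right scale_mult_left)

text \<open>Since \<open>B\<close> is bilinear, its sum over the class formed by
  \<open>tmult\<close> can be computed on the products of the chosen representatives of
  \<open>t\<close> and \<open>t'\<close>.\<close>

lemma (in unital_algebra) tsum_tmult:
  assumes l: "\<And>y. (\<lambda>x. B x y) \<in> Hom scale s2" and r: "\<And>x. B x \<in> Hom scale s2"
  shows "tsum (tmult scale t t') B = tsum t (\<lambda>x y. tsum t' (\<lambda>x' y'. B (x * x') (y * y')))"
  unfolding tmult_def
  by (subst tsum_tensor2)
    (simp_all add: Hom_add[OF l] Hom_add[OF r] Hom_scale[OF l] Hom_scale[OF r]
      sum_list_bind_pairs tsum_def split_def o_def)

lemma (in unital_algebra) tsum3_tmult3: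
  assumes "\<And>y z. (\<lambda>x. B x y z) \<in> Hom scale s2" and "\<And>x z. (\<lambda>y. B x y z) \<in> Hom scale s2"
    and "\<And>x y. B x y \<in> Hom scale s2"
  shows "tsum3 (tmult3 scale t t') B =
    tsum3 t (\<lambda>x y z. tsum3 t' (\<lambda>x' y' z'. B (x * x') (y * y') (z * z')))"
  unfolding tmult3_def
  by (subst tsum3_tensor3)
    (simp_all add: assms[THEN Hom_add] assms[THEN Hom_scale]
      sum_list_bind_pairs tsum3_def split_def o_def)

section \<open>Coalgebras\<close>

context coalgebra
begin

lemma counit_Hom: "\<epsilon> \<in> Hom scale (*)"
  using counit_linear by (simp add: Hom_def)

text \<open>The laws \<open>comult_add\<close> and \<open>comult_scale\<close> are identities of
  classes of formal sums; a bilinear \<open>B\<close> is constant on such classes, so they become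
  linearity in \<open>h\<close>.\<close>

lemma tsum_comult_Hom:
  assumes l: "\<And>y. (\<lambda>x. B x y) \<in> Hom scale s2" and r: "\<And>x. B x \<in> Hom scale s2"
  shows "(\<lambda>h. tsum (\<Delta> h) B) \<in> Hom scale s2"
proof -
  note vs = Hom_vector_space[OF r[of undefined]]
  interpret T: vector_space s2 by (rule vs)
  note eqs = Hom_add[OF l] Hom_add[OF r] Hom_scale[OF l] Hom_scale[OF r]
  have "tsum (\<Delta> (scale c h)) B = s2 c (tsum (\<Delta> h) B)" for c h
    unfolding comult_scale tscale_def T.scale_tsum
    by (subst tsum_tensor2) (simp_all add: eqs tsum_def split_def o_def)
  moreover have "tsum (\<Delta> (g + h)) B = tsum (\<Delta> g) B + tsum (\<Delta> h) B" for g h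
    unfolding comult_add tadd_def
    by (subst tsum_tensor2) (simp_all add: eqs tsum_def split_def o_def)
  ultimately show ?thesis
    unfolding Hom_iff[OF vs] by simp
qed

lemma tsum3_comult2:
  assumes "\<And>y z. (\<lambda>x. B x y z) \<in> Hom scale s2" and "\<And>x z. (\<lambda>y. B x y z) \<in> Hom scale s2"
    and "\<And>x y. B x y \<in> Hom scale s2"
  shows "tsum3 (comult2 scale \<Delta> h) B = tsum (\<Delta> h) (\<lambda>x y. tsum (\<Delta> x) (\<lambda>x1 x2. B x1 x2 y))"
  unfolding comult2_def
  by (subst tsum3_tensor3)
    (simp_all add: assms[THEN Hom_add] assms[THEN Hom_scale]
      sum_list_bind_pairs tsum_def split_def o_def)

text \<open>Coassociativity is an equality of classes of triples, and a trilinear \<open>B\<close>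
  may be evaluated on either of the two lists defining that class.\<close>

lemma tsum_coassoc:
  assumes "\<And>y z. (\<lambda>x. B x y z) \<in> Hom scale s2" and "\<And>x z. (\<lambda>y. B x y z) \<in> Hom scale s2"
    and "\<And>x y. B x y \<in> Hom scale s2"
  shows "tsum (\<Delta> h) (\<lambda>x y. tsum (\<Delta> x) (\<lambda>x1 x2. B x1 x2 y)) =
    tsum (\<Delta> h) (\<lambda>x y. tsum (\<Delta> y) (B x))"
  unfolding tsum3_comult2[OF assms, symmetric] comult2_def coassoc
  by (subst tsum3_tensor3)
    (simp_all add: assms[THEN Hom_add] assms[THEN Hom_scale]
      sum_list_bind_pairs tsum_def split_def o_def)

lemma tsum_counit_left:
  assumes "\<phi> \<in> Hom scale s2"
  shows "tsum (\<Delta> h) (\<lambda>x y. s2 (\<epsilon> x) (\<phi> y)) = \<phi> h"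
  using Hom_apply_tsum[OF assms, of "\<Delta> h" "\<lambda>x y. scale (\<epsilon> x) y"]
  by (simp add: counit_left Hom_scale[OF assms])

lemma tsum_counit_right:
  assumes "\<phi> \<in> Hom scale s2"
  shows "tsum (\<Delta> h) (\<lambda>x y. s2 (\<epsilon> y) (\<phi> x)) = \<phi> h"
  using Hom_apply_tsum[OF assms, of "\<Delta> h" "\<lambda>x y. scale (\<epsilon> y) x"]
  by (simp add: counit_right Hom_scale[OF assms])

end


section \<open>Weak Hopf algebras\<close>

context weak_hopf_algebra
begin

lemma tsum_comult_mult:
  assumes "\<And>y. (\<lambda>x. B x y) \<in> Hom scale s2" and "\<And>x. B x \<in> Hom scale s2"
  shows "tsum (\<Delta> (x * y)) B =
    tsum (\<Delta> x) (\<lambda>x1 x2. tsum (\<Delta> y) (\<lambda>y1 y2. B (x1 * y1) (x2 * y2)))"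
  unfolding comult_mult by (rule tsum_tmult[OF assms])

text \<open>This is \<Delta>^2(1) = (1 \<otimes> \<Delta>(1))(\<Delta>(1) \<otimes> 1) evaluated
  under a trilinear map: \<open>x, y\<close> come from the left factor, \<open>x', y'\<close> from
  the right one, and they meet in the middle leg.\<close>

lemma tsum_comult2_one:
  assumes "\<And>y z. (\<lambda>x. B x y z) \<in> Hom scale s2" and "\<And>x z. (\<lambda>y. B x y z) \<in> Hom scale s2"
    and "\<And>x y. B x y \<in> Hom scale s2"
  shows "tsum (\<Delta> 1) (\<lambda>x y. tsum (\<Delta> 1) (\<lambda>x' y'. B x' (x * y') y)) =
    tsum (\<Delta> 1) (\<lambda>x y. tsum (\<Delta> x) (\<lambda>x1 x2. B x1 x2 y))"
proof -
  let ?D = "rep (\<Delta> 1)"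
  have "tsum3 (tensor3 scale [(x, y, 1). (x, y) \<leftarrow> ?D]) (\<lambda>x' y' z'. B (x * x') (y * y') (z * z'))
      = tsum (\<Delta> 1) (\<lambda>x' y'. B (x * x') (y * y') z)" for x y z
    by (subst tsum3_tensor3)
      (simp_all add: distrib_left scale_mult_right assms[THEN Hom_add] assms[THEN Hom_scale]
        tsum_def split_def o_def)
  then have "tsum3 (comult2 scale \<Delta> 1) B =
      tsum3 (tensor3 scale [(1, x, y). (x, y) \<leftarrow> ?D])
        (\<lambda>x y z. tsum (\<Delta> 1) (\<lambda>x' y'. B (x * x') (y * y') z))"
    unfolding comult2_one(2) tsum3_tmult3[OF assms] by simp
  also have "\<dots> = tsum (\<Delta> 1) (\<lambda>x y. tsum (\<Delta> 1) (\<lambda>x' y'. B x' (x * y') y))"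
    by (subst tsum3_tensor3)
      (simp_all add: distrib_right scale_mult_left tsum_add
        assms[THEN Hom_add] assms[THEN Hom_scale] tsum_def[of _ "\<lambda>x y. tsum (F x y) (G x y)" for F G]
        split_def o_def)
  finally show ?thesis
    unfolding tsum3_comult2[OF assms] ..
qed

section \<open>The counital maps\<close>

lemma eps_t_eq: "eps_t \<Delta> S h = tsum (\<Delta> 1) (\<lambda>x y. scale (\<epsilon> (x * h)) y)"
  unfolding eps_t_def by (rule antipode_target)

lemma eps_s_eq: "eps_s \<Delta> S h = tsum (\<Delta> 1) (\<lambda>x y. scale (\<epsilon> (h * y)) x)"
  unfolding eps_s_def by (rule antipode_source)

lemma Hom_counit_scale:
  assumes "\<phi> \<in> Hom s1 scale" and "vector_space s2"
  shows "(\<lambda>x. s2 (\<epsilon> (\<phi> x)) a) \<in> Hom s1 s2"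
  by (rule Hom_scale_left[OF assms(2) Hom_comp[OF counit_Hom assms(1)]])

lemmas Hom_intros = Hom_id Hom_counit_scale Hom_scale_right Hom_mult_left Hom_mult_right
  Hom_tsum vector_space_axioms

text \<open>Iterating \<open>eps_t\<close> produces two copies of \<Delta>(1) overlapping in the
  middle leg; the axiom on \<Delta>^2(1) merges them, and the counit removes that leg.\<close>

lemma eps_t_idem: "eps_t \<Delta> S (eps_t \<Delta> S h) = eps_t \<Delta> S h"
proof -
  have "eps_t \<Delta> S (eps_t \<Delta> S h) =
      tsum (\<Delta> 1) (\<lambda>x y. tsum (\<Delta> 1) (\<lambda>x' y'. scale (\<epsilon> (x' * h)) (scale (\<epsilon> (x * y')) y)))"
    unfolding eps_t_eq[of "eps_t \<Delta> S h"] unfolding eps_t_eq tsum_mult_left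
      Hom_apply_tsum[OF Hom_counit_scale[OF Hom_id vector_space_axioms]]
    by (simp add: scale_mult_right Hom_scale[OF counit_Hom])
  also have "\<dots> = tsum (\<Delta> 1) (\<lambda>x y. tsum (\<Delta> x) (\<lambda>x1 x2. scale (\<epsilon> (x1 * h)) (scale (\<epsilon> x2) y)))"
    by (rule tsum_comult2_one[where ?s2.0 = scale]) (intro Hom_intros)+
  also have "\<dots> = tsum (\<Delta> 1) (\<lambda>x y. scale (\<epsilon> (x * h)) y)"
    by (subst scale_left_commute, subst tsum_counit_right) (intro Hom_intros | simp)+
  finally show ?thesis
    unfolding eps_t_eq[of h] .
qed

text \<open>The mirror image of the argument for \<open>eps_t\<close>; here the two sums must first
  be exchanged to match the form of the axiom on \<Delta>^2(1).\<close>

lemma eps_s_idem: "eps_s \<Delta> S (eps_s \<Delta> S h) = eps_s \<Delta> S h"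
proof -
  have "eps_s \<Delta> S (eps_s \<Delta> S h) =
      tsum (\<Delta> 1) (\<lambda>x' y'. tsum (\<Delta> 1) (\<lambda>x y. scale (\<epsilon> (h * y)) (scale (\<epsilon> (x * y')) x')))"
    unfolding eps_s_eq[of "eps_s \<Delta> S h"] unfolding eps_s_eq tsum_mult_right
      Hom_apply_tsum[OF Hom_counit_scale[OF Hom_id vector_space_axioms]]
    by (simp add: scale_mult_left Hom_scale[OF counit_Hom])
  also have "\<dots> =
      tsum (\<Delta> 1) (\<lambda>x y. tsum (\<Delta> 1) (\<lambda>x' y'. scale (\<epsilon> (h * y)) (scale (\<epsilon> (x * y')) x')))"
    by (rule tsum_swap)
  also have "\<dots> = tsum (\<Delta> 1) (\<lambda>x y. tsum (\<Delta> x) (\<lambda>x1 x2. scale (\<epsilon> (h * y)) (scale (\<epsilon> x2) x1)))"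
    by (rule tsum_comult2_one[where ?s2.0 = scale]) (intro Hom_intros)+
  also have "\<dots> = tsum (\<Delta> 1) (\<lambda>x y. scale (\<epsilon> (h * y)) x)"
    by (subst scale_left_commute, subst tsum_counit_right) (intro Hom_intros | simp)+
  finally show ?thesis
    unfolding eps_s_eq[of h] .
qed

text \<open>\<open>\<Delta>(1)\<close> lies in \<open>H\<^sub>s \<otimes> H\<close>.\<close>

lemma tsum_comult_one_eps_s:
  assumes "\<And>y. (\<lambda>x. B x y) \<in> Hom scale s2" and "\<And>x. B x \<in> Hom scale s2"
  shows "tsum (\<Delta> 1) (\<lambda>x y. B (eps_s \<Delta> S x) y) = tsum (\<Delta> 1) B"
proof -
  note vs = Hom_vector_space(2)[OF assms(1)]
  have "tsum (\<Delta> 1) (\<lambda>x y. B (eps_s \<Delta> S x) y) =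
      tsum (\<Delta> 1) (\<lambda>x y. tsum (\<Delta> 1) (\<lambda>x' y'. s2 (\<epsilon> (x * y')) (B x' y)))"
    unfolding eps_s_eq Hom_apply_tsum[OF assms(1)] Hom_scale[OF assms(1)] ..
  \<comment> \<open>The two copies of \<Delta>(1) merge into one whose first leg is split again;
    \<open>\<epsilon> x2\<close> then undoes the splitting.\<close>
  also have "\<dots> = tsum (\<Delta> 1) (\<lambda>x y. tsum (\<Delta> x) (\<lambda>x1 x2. s2 (\<epsilon> x2) (B x1 y)))"
    by (rule tsum_comult2_one[where ?s2.0 = s2]) (intro Hom_intros assms vs)+
  also have "\<dots> = tsum (\<Delta> 1) B"
    by (simp add: tsum_counit_right[OF assms(1)])
  finally show ?thesis .
qed

end

section \<open>Partial inverses in semigroups\<close>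

text \<open>Serves for both convolution products, on \<open>H\<close> and on H \<otimes> H. The
  carrier is a set because associativity is only available for linear, respectively bilinear,
  maps.\<close>

locale semigroup_on =
  fixes R :: "'r set" and mul :: "'r \<Rightarrow> 'r \<Rightarrow> 'r" (infixl \<open>\<odot>\<close> 70)
  assumes closed: "x \<in> R \<Longrightarrow> y \<in> R \<Longrightarrow> x \<odot> y \<in> R"
    and assoc: "x \<in> R \<Longrightarrow> y \<in> R \<Longrightarrow> z \<in> R \<Longrightarrow> x \<odot> y \<odot> z = x \<odot> (y \<odot> z)"
begin

lemma ef_inverseD:
  assumes "ef_inverse R mul e f u v"
  shows "u \<in> R" "v \<in> R" "u \<odot> v = e" "v \<odot> u = f" "u \<odot> f = u" "f \<odot> v = v"
  using assms by (auto simp: ef_inverse_def)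

text \<open>e u = u v u = u f = u.\<close>

lemma ef_inverse_left:
  assumes "ef_inverse R mul e f u v"
  shows "e \<odot> u = u"
  using ef_inverseD[OF assms] assoc by metis

text \<open>Each conjugate determines the other: f Z f = v (u Z v) u and u Z v = u (f Z f)
  v.\<close>

lemma conjugate_eq_iff:
  assumes inv: "ef_inverse R mul e f u v" and X: "X \<in> R" and Y: "Y \<in> R"
  shows "u \<odot> X \<odot> v = u \<odot> Y \<odot> v \<longleftrightarrow> f \<odot> X \<odot> f = f \<odot> Y \<odot> f"
proof -
  note D = ef_inverseD[OF inv]
  have f: "f \<in> R" using D closed by metis
  have 1: "f \<odot> Z \<odot> f = v \<odot> (u \<odot> Z \<odot> v) \<odot> u" if "Z \<in> R" for Z
    using D(1,2) that by (simp add: D(4)[symmetric] assoc closed)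
  have 2: "u \<odot> Z \<odot> v = u \<odot> (f \<odot> Z \<odot> f) \<odot> v" if "Z \<in> R" for Z
  proof -
    have "u \<odot> Z \<odot> v = (u \<odot> f) \<odot> Z \<odot> (f \<odot> v)" by (simp add: D)
    also have "\<dots> = u \<odot> (f \<odot> Z \<odot> f) \<odot> v" using D(1,2) f that by (simp add: assoc closed)
    finally show ?thesis .
  qed
  show ?thesis using 1 2 X Y by metis
qed

text \<open>The abstract core of (iii): \<open>I\<close> plays the image of \<open>A\<close>,
  \<open>one\<close> the image of 1, and V M the map \<open>t\<close>.\<close>

lemma conjugations_agree_iff:
  assumes R: "U \<in> R" "V \<in> R" "M \<in> R" "N \<in> R" "I \<subseteq> R"
    and VUV: "V \<odot> U \<odot> V = V" and MNM: "M \<odot> N \<odot> M = M"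
    and comm: "\<And>a. a \<in> I \<Longrightarrow> a \<odot> (V \<odot> U) = V \<odot> U \<odot> a" "\<And>a. a \<in> I \<Longrightarrow> a \<odot> (N \<odot> M) = N \<odot> M \<odot> a"
    and one: "one \<in> I" "U \<odot> one = U" "M \<odot> one = M"
  shows "(\<forall>a\<in>I. U \<odot> a \<odot> V = M \<odot> a \<odot> N) \<longleftrightarrow>
    U \<odot> V = M \<odot> N \<and> (\<forall>a\<in>I. a \<odot> (V \<odot> M) = V \<odot> M \<odot> a)"
proof safe
  assume eq: "\<forall>a\<in>I. U \<odot> a \<odot> V = M \<odot> a \<odot> N"
  show "U \<odot> V = M \<odot> N" using eq one by metis
  fix a assume a: "a \<in> I"
  then have [simp]: "a \<in> R" using R by auto
  note [simp] = R assoc closed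
  \<comment> \<open>Writing V as V U V creates a factor V U past which \<open>a\<close> can move;
    this exposes U a V, which the hypothesis replaces by M a N.\<close>
  have "a \<odot> (V \<odot> M) = a \<odot> ((V \<odot> U \<odot> V) \<odot> M)" unfolding VUV ..
  also have "\<dots> = (a \<odot> (V \<odot> U)) \<odot> (V \<odot> M)" by simp
  also have "\<dots> = V \<odot> (U \<odot> a \<odot> V) \<odot> M" unfolding comm(1)[OF a] by simp
  also have "\<dots> = V \<odot> (M \<odot> a \<odot> N) \<odot> M" using eq a by metis
  also have "\<dots> = V \<odot> (M \<odot> (a \<odot> (N \<odot> M)))" by simp
  also have "\<dots> = V \<odot> (M \<odot> N \<odot> M) \<odot> a" unfolding comm(2)[OF a] by simp
  also have "\<dots> = V \<odot> M \<odot> a" unfolding MNM ..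
  finally show "a \<odot> (V \<odot> M) = V \<odot> M \<odot> a" .
next
  assume UV: "U \<odot> V = M \<odot> N" and t: "\<forall>a\<in>I. a \<odot> (V \<odot> M) = V \<odot> M \<odot> a"
  fix a assume a: "a \<in> I"
  then have [simp]: "a \<in> R" using R by auto
  note [simp] = R assoc closed
  \<comment> \<open>Writing M as M N M = U V M exposes V M, past which \<open>a\<close> moves; the
    remaining M N becomes U V again.\<close>
  have "M \<odot> a \<odot> N = (M \<odot> N \<odot> M) \<odot> a \<odot> N" unfolding MNM ..
  also have "\<dots> = U \<odot> (V \<odot> M \<odot> a) \<odot> N" unfolding UV[symmetric] by simp
  also have "\<dots> = U \<odot> (a \<odot> (V \<odot> M)) \<odot> N" using t a by metis
  also have "\<dots> = U \<odot> a \<odot> V \<odot> (M \<odot> N)" by simp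
  also have "\<dots> = U \<odot> a \<odot> (V \<odot> U \<odot> V)" unfolding UV[symmetric] by simp
  also have "\<dots> = U \<odot> a \<odot> V" unfolding VUV ..
  finally show "U \<odot> a \<odot> V = M \<odot> a \<odot> N" ..
qed

end


section \<open>Convolution\<close>

definition BiHom :: "('k::field \<Rightarrow> 'h::ab_group_add \<Rightarrow> 'h) \<Rightarrow>
    ('k \<Rightarrow> 'a::ab_group_add \<Rightarrow> 'a) \<Rightarrow> ('h \<Rightarrow> 'h \<Rightarrow> 'a) set" where
  "BiHom sH sA = {\<Phi>. (\<forall>y. (\<lambda>x. \<Phi> x y) \<in> Hom sH sA) \<and> (\<forall>x. \<Phi> x \<in> Hom sH sA)}"

text \<open>Convolution of maps on \<open>H \<otimes> H\<close>, given as bilinear maps.\<close>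

definition conv2 :: "('h \<Rightarrow> ('h \<times> 'h) list set) \<Rightarrow> ('h \<Rightarrow> 'h \<Rightarrow> 'a::ring) \<Rightarrow>
    ('h \<Rightarrow> 'h \<Rightarrow> 'a) \<Rightarrow> 'h \<Rightarrow> 'h \<Rightarrow> 'a" where
  "conv2 \<Delta> \<Phi> \<Psi> x y = tsum (\<Delta> x) (\<lambda>x1 x2. conv \<Delta> (\<Phi> x1) (\<Psi> x2) y)"

lemma BiHomD:
  assumes "\<Phi> \<in> BiHom sH sA"
  shows "(\<lambda>x. \<Phi> x y) \<in> Hom sH sA" and "\<Phi> x \<in> Hom sH sA"
  using assms by (auto simp: BiHom_def)

lemma BiHomI:
  assumes "\<And>y. (\<lambda>x. \<Phi> x y) \<in> Hom sH sA" and "\<And>x. \<Phi> x \<in> Hom sH sA"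
  shows "\<Phi> \<in> BiHom sH sA"
  using assms by (auto simp: BiHom_def)

lemma conv_tsum_left:
  "conv \<Delta> (\<lambda>z. tsum t (\<lambda>x y. F x y z)) \<psi> h = tsum t (\<lambda>x y. conv \<Delta> (F x y) \<psi> h)"
  unfolding conv_def tsum_mult_right by (rule tsum_swap)

lemma conv_tsum_right:
  "conv \<Delta> \<psi> (\<lambda>z. tsum t (\<lambda>x y. F x y z)) h = tsum t (\<lambda>x y. conv \<Delta> \<psi> (F x y) h)"
  unfolding conv_def tsum_mult_left by (rule tsum_swap)

locale convolution = coalgebra sH \<Delta> \<epsilon> + A: unital_algebra sA
  for sH :: "'k::field \<Rightarrow> 'h::ab_group_add \<Rightarrow> 'h"
    and \<Delta> :: "'h \<Rightarrow> ('h \<times> 'h) list set"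
    and \<epsilon> :: "'h \<Rightarrow> 'k"
    and sA :: "'k \<Rightarrow> 'a::{ring,monoid_mult} \<Rightarrow> 'a"
begin

lemmas conv_Hom_intros = Hom_tsum A.Hom_mult_left A.Hom_mult_right

lemma conv_closed:
  assumes "\<phi> \<in> Hom sH sA" and "\<psi> \<in> Hom sH sA"
  shows "conv \<Delta> \<phi> \<psi> \<in> Hom sH sA"
  unfolding conv_def[abs_def] by (rule tsum_comult_Hom) (intro conv_Hom_intros assms)+

lemma conv_assoc:
  assumes "\<phi> \<in> Hom sH sA" and "\<psi> \<in> Hom sH sA" and "\<chi> \<in> Hom sH sA"
  shows "conv \<Delta> (conv \<Delta> \<phi> \<psi>) \<chi> = conv \<Delta> \<phi> (conv \<Delta> \<psi> \<chi>)"
proof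
  fix h
  have "conv \<Delta> (conv \<Delta> \<phi> \<psi>) \<chi> h =
      tsum (\<Delta> h) (\<lambda>x y. tsum (\<Delta> x) (\<lambda>x1 x2. \<phi> x1 * (\<psi> x2 * \<chi> y)))"
    by (simp add: conv_def tsum_mult_right mult.assoc)
  also have "\<dots> = tsum (\<Delta> h) (\<lambda>x y. tsum (\<Delta> y) (\<lambda>y1 y2. \<phi> x * (\<psi> y1 * \<chi> y2)))"
    by (rule tsum_coassoc[where ?s2.0 = sA]) (intro conv_Hom_intros assms)+
  finally show "conv \<Delta> (conv \<Delta> \<phi> \<psi>) \<chi> h = conv \<Delta> \<phi> (conv \<Delta> \<psi> \<chi>) h"
    by (simp add: conv_def tsum_mult_left)
qed

sublocale Hom: semigroup_on "Hom sH sA" "conv \<Delta>"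
  by unfold_locales (simp_all add: conv_closed conv_assoc)

section \<open>Convolution on H \<otimes> H\<close>

lemma conv2_closed:
  assumes "\<Phi> \<in> BiHom sH sA" and "\<Psi> \<in> BiHom sH sA"
  shows "conv2 \<Delta> \<Phi> \<Psi> \<in> BiHom sH sA"
proof (rule BiHomI)
  show "(\<lambda>x. conv2 \<Delta> \<Phi> \<Psi> x y) \<in> Hom sH sA" for y
    unfolding conv2_def conv_def
    by (rule tsum_comult_Hom) (intro conv_Hom_intros assms[THEN BiHomD(1)])+
  show "conv2 \<Delta> \<Phi> \<Psi> x \<in> Hom sH sA" for x
    unfolding conv2_def[abs_def] by (intro Hom_tsum conv_closed assms[THEN BiHomD(2)])
qed

text \<open>Associativity of \<open>conv\<close> handles the second variable pointwise;
  coassociativity in the first variable does the rest.\<close>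

lemma conv2_assoc:
  assumes "\<Phi> \<in> BiHom sH sA" and "\<Psi> \<in> BiHom sH sA" and "\<Xi> \<in> BiHom sH sA"
  shows "conv2 \<Delta> (conv2 \<Delta> \<Phi> \<Psi>) \<Xi> = conv2 \<Delta> \<Phi> (conv2 \<Delta> \<Psi> \<Xi>)"
proof (intro ext)
  fix x y
  have "conv2 \<Delta> (conv2 \<Delta> \<Phi> \<Psi>) \<Xi> x y = tsum (\<Delta> x) (\<lambda>x1 x2. tsum (\<Delta> x1)
      (\<lambda>a b. conv \<Delta> (\<Phi> a) (conv \<Delta> (\<Psi> b) (\<Xi> x2)) y))"
    by (simp add: conv2_def[abs_def] conv_tsum_left conv_assoc[OF assms[THEN BiHomD(2)]])
  also have "\<dots> = tsum (\<Delta> x) (\<lambda>x1 x2. tsum (\<Delta> x2)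
      (\<lambda>b c. conv \<Delta> (\<Phi> x1) (conv \<Delta> (\<Psi> b) (\<Xi> c)) y))"
    unfolding conv_def
    by (rule tsum_coassoc[where ?s2.0 = sA]) (intro conv_Hom_intros assms[THEN BiHomD(1)])+
  finally show "conv2 \<Delta> (conv2 \<Delta> \<Phi> \<Psi>) \<Xi> x y = conv2 \<Delta> \<Phi> (conv2 \<Delta> \<Psi> \<Xi>) x y"
    by (simp add: conv2_def[abs_def] conv_tsum_right)
qed

sublocale BiHom: semigroup_on "BiHom sH sA" "conv2 \<Delta>"
  by unfold_locales (simp_all add: conv2_closed conv2_assoc)

text \<open>The algebra map \<open>A \<rightarrow> Hom(H, A)\<close>, \<open>a \<mapsto> \<epsilon>(-)a\<close>, and its analogue for \<open>H \<otimes> H\<close>: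
  through them left and right multiplications by elements of \<open>A\<close> become convolutions.\<close>

definition emb :: "'a \<Rightarrow> 'h \<Rightarrow> 'a" where
  "emb a h = sA (\<epsilon> h) a"

definition emb2 :: "'a \<Rightarrow> 'h \<Rightarrow> 'h \<Rightarrow> 'a" where
  "emb2 a x y = sA (\<epsilon> x) (emb a y)"

lemma emb_Hom: "emb a \<in> Hom sH sA"
  unfolding emb_def[abs_def] by (rule Hom_scale_left[OF A.vector_space_axioms counit_Hom])

lemma emb2_BiHom: "emb2 a \<in> BiHom sH sA"
  unfolding emb2_def[abs_def]
  by (intro BiHomI Hom_scale_left A.vector_space_axioms counit_Hom Hom_scale_right emb_Hom)

lemma conv_emb_right: "\<phi> \<in> Hom sH sA \<Longrightarrow> conv \<Delta> \<phi> (emb a) h = \<phi> h * a"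
  unfolding conv_def emb_def A.scale_mult_right
  using tsum_counit_right[OF A.Hom_mult_right] by simp

lemma conv_emb_left: "\<phi> \<in> Hom sH sA \<Longrightarrow> conv \<Delta> (emb a) \<phi> h = a * \<phi> h"
  unfolding conv_def emb_def A.scale_mult_left
  using tsum_counit_left[OF A.Hom_mult_left] by simp

text \<open>The counit is absorbed first in \<open>y\<close>, inside the inner convolution, and then
  in \<open>x\<close>.\<close>

lemma conv2_emb2_right:
  assumes "\<Phi> \<in> BiHom sH sA"
  shows "conv2 \<Delta> \<Phi> (emb2 a) x y = \<Phi> x y * a"
proof -
  have "conv \<Delta> (\<Phi> x1) (emb2 a x2) y = sA (\<epsilon> x2) (\<Phi> x1 y * a)" for x1 x2
    unfolding conv_emb_right[OF BiHomD(2)[OF assms], symmetric]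
    unfolding conv_def emb2_def A.scale_mult_right A.scale_tsum ..
  then show ?thesis
    unfolding conv2_def
    by (simp add: tsum_counit_right[OF A.Hom_mult_right[OF BiHomD(1)[OF assms]]])
qed

lemma conv2_emb2_left:
  assumes "\<Phi> \<in> BiHom sH sA"
  shows "conv2 \<Delta> (emb2 a) \<Phi> x y = a * \<Phi> x y"
proof -
  have "conv \<Delta> (emb2 a x1) (\<Phi> x2) y = sA (\<epsilon> x1) (a * \<Phi> x2 y)" for x1 x2
    unfolding conv_emb_left[OF BiHomD(2)[OF assms], symmetric]
    unfolding conv_def emb2_def A.scale_mult_left A.scale_tsum ..
  then show ?thesis
    unfolding conv2_def
    by (simp add: tsum_counit_left[OF A.Hom_mult_left[OF BiHomD(1)[OF assms]]])
qed

section \<open>The action as a convolution product, and statement (i)\<close>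

lemma act_eq_conv:
  assumes "u \<in> Hom sH sA"
  shows "(\<lambda>h. act \<Delta> u v h a) = conv \<Delta> (conv \<Delta> u (emb a)) v"
  by (simp add: fun_eq_iff act_def conv_def[of _ "conv \<Delta> u (emb a)"] conv_emb_right[OF assms])

lemma phi_eq_act: "phi \<Delta> f h a = act \<Delta> f f h a"
  by (simp add: phi_def act_def)

text \<open>The product (u a v)(u b v) is bracketed around v u, which is \<open>f\<close> for the
  action and f f = f when both maps are \<open>f\<close>.\<close>

lemma tsum_act:
  assumes "u \<in> Hom sH sA" and "v \<in> Hom sH sA"
  shows "(\<lambda>h. tsum (\<Delta> h) (\<lambda>h1 h2. act \<Delta> u v h1 a * act \<Delta> u v h2 b)) =
    conv \<Delta> (conv \<Delta> u (conv \<Delta> (emb a) (conv \<Delta> (conv \<Delta> v u) (emb b)))) v"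
proof -
  have "(\<lambda>h. tsum (\<Delta> h) (\<lambda>h1 h2. act \<Delta> u v h1 a * act \<Delta> u v h2 b)) =
    conv \<Delta> (\<lambda>h. act \<Delta> u v h a) (\<lambda>h. act \<Delta> u v h b)"
    by (simp add: fun_eq_iff conv_def)
  then show ?thesis
    unfolding act_eq_conv[OF assms(1)] by (simp add: conv_assoc conv_closed emb_Hom assms)
qed

context
  fixes e f u v :: "'h \<Rightarrow> 'a"
  assumes inv: "ef_inverse (Hom sH sA) (conv \<Delta>) e f u v"
begin

lemmas inv_simps = Hom.ef_inverseD[OF inv]

lemma act_one: "act \<Delta> u v h 1 = e h"
  by (simp add: act_def inv_simps(3)[symmetric] conv_def)

lemma act_mult_iff:
  assumes "idempotent_in (Hom sH sA) (conv \<Delta>) f"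
  shows "(\<forall>h a b. act \<Delta> u v h (a * b) = tsum (\<Delta> h) (\<lambda>h1 h2. act \<Delta> u v h1 a * act \<Delta> u v h2 b))
    \<longleftrightarrow> (\<forall>h a b. phi \<Delta> f h (a * b) = tsum (\<Delta> h) (\<lambda>h1 h2. phi \<Delta> f h1 a * phi \<Delta> f h2 b))"
proof -
  have f: "f \<in> Hom sH sA" "conv \<Delta> f f = f"
    using assms by (auto simp: idempotent_in_def)
  \<comment> \<open>For fixed \<open>a\<close> and \<open>b\<close> this is
    \<open>Hom.conjugate_eq_iff\<close> with X = \<open>emb (a * b)\<close> and Y the convolution
    product of \<open>emb a\<close>, \<open>f\<close> and \<open>emb b\<close>.\<close>
  have "(\<forall>h. act \<Delta> u v h (a * b) = tsum (\<Delta> h) (\<lambda>h1 h2. act \<Delta> u v h1 a * act \<Delta> u v h2 b)) \<longleftrightarrow>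
      (\<forall>h. phi \<Delta> f h (a * b) = tsum (\<Delta> h) (\<lambda>h1 h2. phi \<Delta> f h1 a * phi \<Delta> f h2 b))" for a b
    unfolding fun_eq_iff[symmetric] phi_eq_act
      tsum_act[OF inv_simps(1,2)] tsum_act[OF f(1) f(1)] act_eq_conv[OF inv_simps(1)] act_eq_conv[OF f(1)] f(2) inv_simps(4)
    by (rule Hom.conjugate_eq_iff[OF inv]) (intro Hom.closed emb_Hom f)+
  then show ?thesis by metis
qed

end

end

section \<open>The action of a weak Hopf algebra\<close>

locale weak_hopf_convolution = weak_hopf_algebra sH \<Delta> \<epsilon> S + A: unital_algebra sA
  for sH :: "'k::field \<Rightarrow> 'h::{ring,monoid_mult} \<Rightarrow> 'h"
    and \<Delta> :: "'h \<Rightarrow> ('h \<times> 'h) list set"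
    and \<epsilon> :: "'h \<Rightarrow> 'k"
    and S :: "'h \<Rightarrow> 'h"
    and sA :: "'k \<Rightarrow> 'a::{ring,monoid_mult} \<Rightarrow> 'a"
begin

sublocale convolution sH \<Delta> \<epsilon> sA
  by unfold_locales

lemma Hom_mult_BiHom:
  assumes "\<phi> \<in> Hom sH sA"
  shows "(\<lambda>x y. \<phi> (x * y)) \<in> BiHom sH sA"
  by (intro BiHomI Hom_comp[OF assms] Hom_mult_left Hom_mult_right Hom_id)

text \<open>Multiplicativity of \<Delta> makes pullback along the product of \<open>H\<close>
  compatible with convolution.\<close>

lemma conv2_comp_mult:
  assumes "\<phi> \<in> Hom sH sA" and "\<psi> \<in> Hom sH sA"
  shows "conv2 \<Delta> (\<lambda>x y. \<phi> (x * y)) (\<lambda>x y. \<psi> (x * y)) = (\<lambda>x y. conv \<Delta> \<phi> \<psi> (x * y))"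
proof (intro ext)
  fix x y
  show "conv2 \<Delta> (\<lambda>x y. \<phi> (x * y)) (\<lambda>x y. \<psi> (x * y)) x y = conv \<Delta> \<phi> \<psi> (x * y)"
    unfolding conv2_def conv_def
    by (rule tsum_comult_mult[symmetric, where ?s2.0 = sA]) (intro conv_Hom_intros assms)+
qed

context
  fixes e f u v :: "'h \<Rightarrow> 'a"
  assumes inv: "ef_inverse (Hom sH sA) (conv \<Delta>) e f u v"
begin

lemmas inv_simps = inv_simps[OF inv]

lemma e_Hom: "e \<in> Hom sH sA"
  using inv_simps Hom.closed by metis

section \<open>Statement (ii): the target counital map and the kernel of \<open>e\<close>\<close>

lemma comp_eps_t_iff: "e \<circ> eps_t \<Delta> S = e \<longleftrightarrow> {h. eps_t \<Delta> S h = 0} \<subseteq> {h. e h = 0}"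
proof
  assume "e \<circ> eps_t \<Delta> S = e"
  then show "{h. eps_t \<Delta> S h = 0} \<subseteq> {h. e h = 0}"
    using Hom_0[OF e_Hom] by (auto simp: fun_eq_iff) metis
next
  assume ker: "{h. eps_t \<Delta> S h = 0} \<subseteq> {h. e h = 0}"
  have "eps_t \<Delta> S \<in> Hom sH sH"
    unfolding eps_t_eq[abs_def] by (intro Hom_intros)
  \<comment> \<open>Idempotence places the difference of \<open>h\<close> and its image under
    \<open>eps_t\<close> in the kernel, where \<open>e\<close> vanishes.\<close>
  then have "eps_t \<Delta> S (h - eps_t \<Delta> S h) = 0" for h
    by (simp add: Hom_diff eps_t_idem)
  then have "e (h - eps_t \<Delta> S h) = 0" for h
    using ker by blast
  then show "e \<circ> eps_t \<Delta> S = e"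
    by (simp add: fun_eq_iff Hom_diff[OF e_Hom])
qed

section \<open>Statement (iii): associativity of the action\<close>

lemma act_act_iff:
  assumes central: "range f \<subseteq> center"
  shows "(\<forall>g h a. act \<Delta> u v g (act \<Delta> u v h a) = act \<Delta> u v (g * h) a) \<longleftrightarrow>
    (\<forall>g h. act \<Delta> u v g (e h) = e (g * h)) \<and> (\<forall>x y. tmap \<Delta> u v x y \<in> center)"
proof -
  note u = inv_simps(1) and v = inv_simps(2)
  have f_comm: "f x * a = a * f x" for x a
    using central by (auto simp: center_def)
  define U V M N where "U = (\<lambda>x y. u x * u y)" and "V = (\<lambda>x y. v y * v x)"
    and "M = (\<lambda>x y. u (x * y))" and "N = (\<lambda>x y. v (x * y))"
  have UV: "U \<in> BiHom sH sA" "V \<in> BiHom sH sA"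
    unfolding U_def V_def by (intro BiHomI conv_Hom_intros u v)+
  have UV_apply: "U x y = u x * u y" "V x y = v y * v x" for x y
    by (simp_all add: U_def V_def)
  have MN: "M \<in> BiHom sH sA" "N \<in> BiHom sH sA"
    unfolding M_def N_def by (intro Hom_mult_BiHom u v)+
  \<comment> \<open>Exchanging the sums lets the inner v(x1) u(x2) collapse to \<open>f x\<close>,
    which is central and moves out to the left.\<close>
  have VU: "conv2 \<Delta> V U x y = f x * f y" for x y
  proof -
    have "conv2 \<Delta> V U x y =
        tsum (\<Delta> y) (\<lambda>y1 y2. tsum (\<Delta> x) (\<lambda>x1 x2. v y1 * (v x1 * (u x2 * u y2))))"
      unfolding conv2_def conv_def V_def U_def mult.assoc by (rule tsum_swap)
    also have "\<dots> = tsum (\<Delta> y) (\<lambda>y1 y2. v y1 * f x * u y2)"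
      unfolding inv_simps(4)[symmetric] conv_def[of _ v u x] tsum_mult_left tsum_mult_right mult.assoc ..
    also have "\<dots> = tsum (\<Delta> y) (\<lambda>y1 y2. f x * (v y1 * u y2))"
      by (simp add: f_comm[symmetric] mult.assoc)
    also have "\<dots> = f x * f y"
      unfolding tsum_mult_left[symmetric] inv_simps(4)[symmetric] conv_def[of _ v u y] ..
    finally show ?thesis .
  qed
  \<comment> \<open>The convolution of \<open>f\<close> and \<open>v\<close> collapses to
    \<open>v\<close> in \<open>y\<close> first; centrality of \<open>f x1\<close> then pulls
    \<open>v y\<close> out, and the same collapse occurs in \<open>x\<close>.\<close>
  have "conv2 \<Delta> (conv2 \<Delta> V U) V x y = V x y" for x y
  proof -
    have "conv2 \<Delta> (conv2 \<Delta> V U) V x y =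
        tsum (\<Delta> x) (\<lambda>x1 x2. f x1 * (conv \<Delta> f v y * v x2))"
      by (simp add: conv2_def[of _ "conv2 \<Delta> V U"] conv_def[of _ _ _ y] VU UV_apply
          tsum_mult_left tsum_mult_right mult.assoc)
    also have "\<dots> = tsum (\<Delta> x) (\<lambda>x1 x2. v y * (f x1 * v x2))"
      unfolding inv_simps(6) by (metis f_comm mult.assoc)
    also have "\<dots> = v y * conv \<Delta> f v x"
      unfolding tsum_mult_left[symmetric] conv_def[of _ f v x] ..
    finally show ?thesis
      unfolding inv_simps(6) UV_apply .
  qed
  then have VUV: "conv2 \<Delta> (conv2 \<Delta> V U) V = V" by (simp add: fun_eq_iff)
  have MN_e: "conv2 \<Delta> M N = (\<lambda>x y. e (x * y))" and NM: "conv2 \<Delta> N M = (\<lambda>x y. f (x * y))"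
    unfolding M_def N_def by (simp_all add: conv2_comp_mult u v inv_simps)
  \<comment> \<open>The identity e u = u, pulled back along multiplication.\<close>
  have MNM: "conv2 \<Delta> (conv2 \<Delta> M N) M = M"
    unfolding MN_e unfolding M_def by (simp add: conv2_comp_mult e_Hom u Hom.ef_inverse_left[OF inv])
  have act_act: "act \<Delta> u v g (act \<Delta> u v h a) = conv2 \<Delta> (conv2 \<Delta> U (emb2 a)) V g h" for g h a
    by (simp add: conv2_def[of _ "conv2 \<Delta> U (emb2 a)"] conv_def[of _ _ _ h] conv2_emb2_right[OF UV(1)]
        UV_apply act_def tsum_mult_left tsum_mult_right mult.assoc)
  have act_mult: "act \<Delta> u v (g * h) a = conv2 \<Delta> (conv2 \<Delta> M (emb2 a)) N g h" for g h a
  proof -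
    have "act \<Delta> u v (g * h) a = conv \<Delta> (\<lambda>x. u x * a) v (g * h)"
      by (simp add: act_def conv_def)
    also have "\<dots> = conv2 \<Delta> (\<lambda>x y. u (x * y) * a) N g h"
      unfolding N_def using conv2_comp_mult[OF A.Hom_mult_right[OF u] v] by metis
    also have "(\<lambda>x y. u (x * y) * a) = conv2 \<Delta> M (emb2 a)"
      by (simp add: fun_eq_iff conv2_emb2_right[OF MN(1)]) (simp add: M_def)
    finally show ?thesis .
  qed
  \<comment> \<open>Since \<open>e h\<close> is the action of \<open>h\<close> on 1, this is
    \<open>act_act\<close> at a = 1.\<close>
  have act_e: "act \<Delta> u v g (e h) = conv2 \<Delta> U V g h" for g h
  proof -
    have "conv2 \<Delta> U (emb2 1) = U"
      by (simp add: fun_eq_iff conv2_emb2_right[OF UV(1)])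
    then show ?thesis
      using act_act[of g h 1] by (simp add: act_one[OF inv])
  qed
  have tmap: "tmap \<Delta> u v x y = conv2 \<Delta> V M x y" for x y
    by (simp add: tmap_def conv2_def conv_def V_def M_def)
  have "(\<forall>a\<in>range emb2. conv2 \<Delta> (conv2 \<Delta> U a) V = conv2 \<Delta> (conv2 \<Delta> M a) N) \<longleftrightarrow>
    conv2 \<Delta> U V = conv2 \<Delta> M N \<and>
    (\<forall>a\<in>range emb2. conv2 \<Delta> a (conv2 \<Delta> V M) = conv2 \<Delta> (conv2 \<Delta> V M) a)"
  proof (rule BiHom.conjugations_agree_iff[where one = "emb2 1"])
    fix a assume "a \<in> range emb2"
    then obtain b where a: "a = emb2 b" ..
    \<comment> \<open>The values of V U are the products \<open>f x * f y\<close> and those of N M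
      are \<open>f (x * y)\<close>, all central.\<close>
    show "conv2 \<Delta> a (conv2 \<Delta> V U) = conv2 \<Delta> (conv2 \<Delta> V U) a"
      unfolding a fun_eq_iff
      by (simp add: conv2_emb2_left conv2_emb2_right conv2_closed UV) (metis VU f_comm mult.assoc)
    show "conv2 \<Delta> a (conv2 \<Delta> N M) = conv2 \<Delta> (conv2 \<Delta> N M) a"
      unfolding a fun_eq_iff
      by (simp add: conv2_emb2_left conv2_emb2_right conv2_closed MN) (simp add: NM f_comm)
  qed (use UV MN VUV MNM emb2_BiHom in \<open>auto simp: fun_eq_iff conv2_emb2_right\<close>)
  then show ?thesis
    unfolding act_act act_mult act_e tmap
    by (auto simp: fun_eq_iff MN_e center_def conv2_emb2_left conv2_emb2_right conv2_closed UV MN)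
qed

section \<open>Statements (iv) and (v): the action of the unit\<close>

lemma act_unit:
  assumes central: "u ` H_s \<Delta> S \<subseteq> center" and "e 1 = 1"
  shows "act \<Delta> u v 1 a = a"
proof -
  have comm: "u (eps_s \<Delta> S x) * a = a * u (eps_s \<Delta> S x)" for x
  proof -
    have "eps_s \<Delta> S x \<in> H_s \<Delta> S"
      by (simp add: H_s_def eps_s_idem)
    then show ?thesis
      using central by (auto simp: center_def)
  qed
  \<comment> \<open>Inserting \<open>eps_s\<close> in the first leg moves \<open>u\<close> to
    arguments in \<open>H_s\<close>, where its values are central; once \<open>a\<close> has been
    pulled out, \<open>eps_s\<close> is removed again.\<close>
  have "act \<Delta> u v 1 a = tsum (\<Delta> 1) (\<lambda>x y. u (eps_s \<Delta> S x) * a * v y)"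
    unfolding act_def
    by (rule tsum_comult_one_eps_s[symmetric, where ?s2.0 = sA]) (intro conv_Hom_intros inv_simps)+
  also have "\<dots> = tsum (\<Delta> 1) (\<lambda>x y. a * (u (eps_s \<Delta> S x) * v y))"
    by (simp add: comm mult.assoc)
  also have "\<dots> = tsum (\<Delta> 1) (\<lambda>x y. a * (u x * v y))"
    by (rule tsum_comult_one_eps_s[where ?s2.0 = sA]) (intro conv_Hom_intros inv_simps)+
  also have "\<dots> = a * e 1"
    by (simp add: inv_simps(3)[symmetric] conv_def tsum_mult_left)
  finally show ?thesis
    using assms by simp
qed

text \<open>Applying x \<otimes> y \<mapsto> x a y to (s \<otimes> 1) \<lambda>(1) = \<lambda>(1) (1
  \<otimes> s) turns the two sides into \<open>s\<close> times the action of 1 on \<open>a\<close>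
  and that action times \<open>s\<close>.\<close>

lemma central_if_act_unit:
  assumes "lambda1 sA \<Delta> u v \<in> C_tensor sA (u ` H_s \<Delta> S)" and unit: "\<And>a. act \<Delta> u v 1 a = a"
  shows "u ` H_s \<Delta> S \<subseteq> center"
proof
  fix s assume "s \<in> u ` H_s \<Delta> S"
  then have eq: "tmult sA (tensor2 sA [(s, 1)]) (lambda1 sA \<Delta> u v) =
      tmult sA (lambda1 sA \<Delta> u v) (tensor2 sA [(1, s)])"
    using assms(1) by (auto simp: C_tensor_def)
  show "s \<in> center"
    unfolding center_def
  proof safe
    fix a :: 'a
    let ?B = "\<lambda>x y. x * a * y"
    \<comment> \<open>The outer factors allow one computation for both sides: c = s, d = 1 on the
      left and c = 1, d = s on the right.\<close>
    have sandwich: "tsum (lambda1 sA \<Delta> u v) (\<lambda>x y. c * x * a * y * d) = c * a * d" for c d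
    proof -
      have "tsum (lambda1 sA \<Delta> u v) (\<lambda>x y. c * x * a * y * d) =
          tsum (\<Delta> 1) (\<lambda>x y. c * (u x * a * v y) * d)"
        unfolding lambda1_def
        by (subst tsum_tensor2)
          (simp_all add: algebra_simps A.scale_mult_left A.scale_mult_right tsum_def split_def o_def)
      also have "\<dots> = c * act \<Delta> u v 1 a * d"
        by (simp add: act_def tsum_mult_left tsum_mult_right)
      finally show ?thesis unfolding unit .
    qed
    have "tsum (tmult sA (tensor2 sA [(s, 1)]) (lambda1 sA \<Delta> u v)) ?B = s * a"
    proof -
      have "tsum (tmult sA (tensor2 sA [(s, 1)]) (lambda1 sA \<Delta> u v)) ?B =
          tsum (tensor2 sA [(s, 1)]) (\<lambda>x y. tsum (lambda1 sA \<Delta> u v) (\<lambda>x' y'. x * x' * a * (y * y')))"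
        by (rule A.tsum_tmult[where ?s2.0 = sA]) (intro conv_Hom_intros A.Hom_id)+
      also have "\<dots> = tsum (lambda1 sA \<Delta> u v) (\<lambda>x' y'. s * x' * a * y')"
        by (subst tsum_tensor2)
          (simp_all add: distrib_left distrib_right A.scale_mult_left A.scale_mult_right tsum_add)
      finally show ?thesis using sandwich[of s 1] by simp
    qed
    moreover have "tsum (tmult sA (lambda1 sA \<Delta> u v) (tensor2 sA [(1, s)])) ?B = a * s"
    proof -
      have "tsum (tmult sA (lambda1 sA \<Delta> u v) (tensor2 sA [(1, s)])) ?B =
          tsum (lambda1 sA \<Delta> u v) (\<lambda>x y. tsum (tensor2 sA [(1, s)]) (\<lambda>x' y'. x * x' * a * (y * y')))"
        by (rule A.tsum_tmult[where ?s2.0 = sA]) (intro conv_Hom_intros A.Hom_id)+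
      also have "\<dots> = tsum (lambda1 sA \<Delta> u v) (\<lambda>x y. x * a * (y * s))"
        by (subst tsum_tensor2) (simp_all add: algebra_simps A.scale_mult_left A.scale_mult_right)
      finally show ?thesis using sandwich[of 1 s] by (simp add: mult.assoc)
    qed
    ultimately show "s * a = a * s" unfolding eq by simp
  qed
qed

end

end

theorem theorem3p5:
  fixes sH :: "'k::field \<Rightarrow> 'h::{ring,monoid_mult} \<Rightarrow> 'h"
    and \<Delta> :: "'h \<Rightarrow> ('h \<times> 'h) list set"
    and \<epsilon> :: "'h \<Rightarrow> 'k"
    and S :: "'h \<Rightarrow> 'h"
    and sA :: "'k \<Rightarrow> 'a::{ring,monoid_mult} \<Rightarrow> 'a"
    and e f u v :: "'h \<Rightarrow> 'a"
  assumes "weak_hopf_algebra sH \<Delta> \<epsilon> S"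
    and "unital_algebra sA"
    and "idempotent_in (Hom sH sA) (conv \<Delta>) e" and "e \<noteq> (\<lambda>h. 0)"
    and "idempotent_in (Hom sH sA) (conv \<Delta>) f" and "f \<noteq> (\<lambda>h. 0)"
    and "ef_inverse (Hom sH sA) (conv \<Delta>) e f u v"
  shows "((\<forall>h a b. act \<Delta> u v h (a * b) = tsum (\<Delta> h) (\<lambda>h1 h2. act \<Delta> u v h1 a * act \<Delta> u v h2 b))
          \<longleftrightarrow> (\<forall>h a b. phi \<Delta> f h (a * b) = tsum (\<Delta> h) (\<lambda>h1 h2. phi \<Delta> f h1 a * phi \<Delta> f h2 b)))
    \<and> (((\<forall>h. act \<Delta> u v h 1 = act \<Delta> u v (eps_t \<Delta> S h) 1) \<longleftrightarrow> e \<circ> eps_t \<Delta> S = e)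
       \<and> (e \<circ> eps_t \<Delta> S = e \<longleftrightarrow> {h. eps_t \<Delta> S h = 0} \<subseteq> {h. e h = 0}))
    \<and> (range f \<subseteq> center \<longrightarrow>
         ((\<forall>g h a. act \<Delta> u v g (act \<Delta> u v h a) = act \<Delta> u v (g * h) a)
          \<longleftrightarrow> (\<forall>g h. act \<Delta> u v g (e h) = e (g * h)) \<and> (\<forall>x y. tmap \<Delta> u v x y \<in> center)))
    \<and> (u ` H_s \<Delta> S \<subseteq> center \<and> e 1 = 1 \<longrightarrow> (\<forall>a. act \<Delta> u v 1 a = a))
    \<and> (lambda1 sA \<Delta> u v \<in> C_tensor sA (u ` H_s \<Delta> S) \<and> (\<forall>a. act \<Delta> u v 1 a = a)
         \<longrightarrow> e 1 = 1 \<and> u ` H_s \<Delta> S \<subseteq> center)"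
proof -
  interpret weak_hopf_convolution sH \<Delta> \<epsilon> S sA
    using assms(1,2) by (simp add: weak_hopf_convolution_def)
  note inv = assms(7)
  show ?thesis
  proof (intro conjI impI)
    show "(\<forall>h. act \<Delta> u v h 1 = act \<Delta> u v (eps_t \<Delta> S h) 1) \<longleftrightarrow> e \<circ> eps_t \<Delta> S = e"
      unfolding act_one[OF inv] by (auto simp: fun_eq_iff)
    \<comment> \<open>The unit condition at a = 1, since \<open>e 1\<close> is the action of 1 on
      1.\<close>
    show "e 1 = 1" if "lambda1 sA \<Delta> u v \<in> C_tensor sA (u ` H_s \<Delta> S) \<and> (\<forall>a. act \<Delta> u v 1 a = a)"
      using that act_one[OF inv, of 1] by simp
  qed (simp_all only: act_mult_iff[OF inv assms(5)] comp_eps_t_iff[OF inv] act_act_iff[OF inv]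
      act_unit[OF inv] central_if_act_unit[OF inv] simp_thms)
qed

end
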